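(* Consider the multi-horizon stochastic program (MHSP) and the stabilised adaptive Benders algorithm (the Algorithm), both as defined in the context. If all the subproblems are linear programming problems, then the Algorithm with convergence tolerance $\epsilon$ converges in a finite number of iterations to an $\epsilon$-optimal solution of the MHSP.
   Context: **Problem (MHSP).** $\mathcal I$ is the finite set of strategic nodes of a scenario tree with root $1$, $A_i$ is the ancestor node of $i\neq 1$, and $\pi_i$ is the probability of node $i$ (the $\pi_i$ sum to 1 over each strategic stage). The problem is $$\min_{\mathbf x\in\mathcal X}\ \sum_{i\in\mathcal I}\pi_i\big(c_i^\top x_i+g(x_i^O,q_i)\big)\quad\text{s.t.}\quad T^I_{A_i}x_{A_i}+W^I_ix_i\le h^I_i\ (i\in\mathcal I\setminus\{1\}),\quad W^I_1x_1\le h^I_1, \qquad (S)$$ where $\mathbf x=(x_i)_{i\in\mathcal I}$, $\mathcal X$ encodes the bounds on the elements of $\mathbf x$ and whether they are integer or continuous, and $x_i^O$ is the part of $x_i$ that affects subproblem $i$. Subproblem $i$ is $$g(x_i^O,q_i):=\min_{y_i\in\mathcal Y}\{q_i^\top Qy_i:\ T^Ox_i^O+W^Oy_i\le h^O\},$$ where $\mathcal Y$ encodes bounds on the elements of $y_i$, all of which are continuous variables. The dimensions of $x_i^O$, $q_i$, $y_i$ are the same for all $i$, and $Q,T^O,W^O,h^O$ do not depend on $i$. A point $\mathbf x\in\mathcal X$ satisfying the constraints in $(S)$ is $\epsilon$-optimal if its objective value is at most the optimal value plus $\epsilon$. **Standing condition for the adaptive oracles.** $g(x^O_i,q_i)$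 is convex with respect to the vector $x^O_i$ and concave with respect to the vector $q_i$, and it is a decreasing function of the elements of $x^O_i$ and an increasing function of the elements of $q_i$. **Exact solutions.** When subproblem $i$ is solved exactly at $(x,q_i)$, the solver returns the optimal value $\theta=g(x,q_i)$ and the subgradients $\lambda$ and $\phi$ of $g$ with respect to $x$ and $q_i$ respectively at that point (for the concave dependence on $q_i$, $\phi$ is a supergradient). **Adaptive oracles.** $\mathcal S$ is a finite collection of vectors $(x_s,q_s,\theta_s,\lambda_s,\phi_s)$ obtained from exact solutions at points $(x_s,q_s)$. Called at $(x,q)$, the oracles return $$\underline\theta=\max_{\mu\ge0}\Big\{\sum_s\mu_s\big(\theta_s+\lambda_s^\top(x-x_s)\big):\sum_s\mu_sq_s\le q,\ \sum_s\mu_s=1\Big\},\qquad \underline\lambda=\sum_s\mu_s^*\lambda_s\ (\mu^*\text{ an optimal }\mu),$$ $$\overline\theta=\min_{\mu\ge0}\Big\{\sum_s\mu_s\big(\theta_s+\phi_s^\top(q-q_s)\big):\sum_s\mu_sx_s\le x,\ \sum_s\mu_s=1\Big\}.$$ $\mathcal S$ always contains the entry from a special point $(\underline x^O,\underline q)$, where $\underline x^O\le x_i^O$ for every $x_i^O$ at which the oracles are called and $\underline q\le q_i$ for all $i$ (componentwise). Under the standing condition, when called at $(\hat x^O_{ij},q_i)$ and returning $\underline\theta_{ij},\overline\theta_{ij},\underline\lambda_{ij}$, the oracles satisfy $\underline\theta_{ij}+\underline\lambda_{ij}^\top(x_i^O-\hat x_{ij}^O)\le g(x_i^O,q_i)$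 for all $x_i^O$, and $g(\hat x^O_{ij},q_i)\le\overline\theta_{ij}$. **Reduced master problem (RMP) at iteration $j$.** Minimise $\sum_i\pi_i(c_i^\top x_i+\beta_i)$ over $\mathbf x\in\mathcal X$ satisfying the constraints in $(S)$ and over $\beta_i\ge\underline\beta$ (where $\underline\beta$ is an initial lower bound for the $\beta_i$), subject to the cuts $\beta_i\ge\underline\theta_{ik}+\underline\lambda_{ik}^\top(x_i^O-\hat x_{ik}^O)$ for $i\in\mathcal I$, $k<j$. **Centred point problem (CP) at iteration $j$ with target $T_j$.** The linear feasibility problem of finding a (well-centred) point of the polyhedron given by the RMP constraints with integrality relaxed together with $\sum_i\pi_i(c_i^\top x_i+\beta_i)\le T_j$. **The Algorithm.** Choose the convergence tolerance $\epsilon$, the stabilisation factor $\gamma_0\in(0,1)$, $\underline\beta$, $\epsilon^0$, $\omega\in(0,1)$, $\underline P\in(0,1)$, $\overline P\in(\underline P,1)$. Set $U^*_0:=+\infty$, $\xi:=0$, initial centred point $\mathbf x^{CP}:=0$, $j:=0$. Solve the subproblem exactly at $(\underline x^O,\underline q)$, obtaining $\theta,\lambda,\phi$, and set $\mathcal S:=\{(\underline x^O,\underline q,\theta,\lambda,\phi)\}$. Repeat the following outer iteration: 1. $j:=j+1$. Solve the RMP, obtaining $\mathbf x_j^{RMP}$ and $\beta_{ij}$. Set $L_j^*:=\sum_i\pi_i(c_i^\top x_{ij}^{RMP}+\beta_{ij})$ and $\hat{\mathbf x}_j:=\mathbf x_j^{RMP}$. 2. If $j\ge2$ and $\xi=1$: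 set $T_j:=L_j^*+\gamma_j(U^*_{j-1}-L_j^* )$ and solve the CP to obtain $\mathbf x^{CP}_j$; if $\|\mathbf x^{CP}_j-\mathbf x^{CP}_{j-1}\|\le\epsilon^0$, set $\hat{\mathbf x}_j:=\mathbf x^{CP}_j$. Otherwise (i.e. if $j<2$ or $\xi\ne1$) set $\mathbf x^{CP}_j:=\mathbf x^{CP}_{j-1}$. 3. For every $i\in\mathcal I$, call the oracles at $(\hat x_{ij}^O,q_i)$ to obtain $\underline\theta_{ij},\overline\theta_{ij},\underline\lambda_{ij}$. Set $\xi:=0$. 4. Inner loop, repeat: (a) if $\max_i\pi_i(\overline\theta_{ij}-\underline\theta_{ij})=0$, exit the inner loop; (b) let $\hat i:=\arg\max_{i}\pi_i(\overline\theta_{ij}-\underline\theta_{ij})$ and solve subproblem $\hat i$ exactly at $(\hat x^O_{\hat ij},q_{\hat i})$, obtaining $\theta_{\hat ij},\lambda_{\hat ij},\phi_{\hat ij}$; (c) if $\theta_{\hat ij}>\underline\theta_{\hat ij}$, then set $\xi:=1$ and $\mathcal S:=\mathcal S\cup\{(\hat x^O_{\hat ij},q_{\hat i},\theta_{\hat ij},\lambda_{\hat ij},\phi_{\hat ij})\}$; (d) for every $i\in\mathcal I$ call the oracles at $(\hat x^O_{ij},q_i)$ and obtain (updated) $\underline\theta_{ij},\overline\theta_{ij},\underline\lambda_{ij}$; (e) set $\hat L_j:=\sum_i\pi_i(c_i^\top\hat x_{ij}+\underline\theta_{ij})$ and $\hat U_j:=\sum_i\pi_i(c_i^\top\hat x_{ij}+\overline\theta_{ij})$;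 until ($\hat U_j-\hat L_j\le U^*_{j-1}-L^*_{j-1}$ and $\xi=1$) or $\hat L_j\ge U^*_{j-1}$. (For $j=1$ the first inequality counts as true since $U_0^*=+\infty$.) 5. For every $i\in\mathcal I$ call the upper bound oracle at $(x_{ij}^{RMP,O},q_i)$ to obtain $\overline\theta_{ij}$, where $x_{ij}^{RMP,O}$ is the part of $x_{ij}^{RMP}$ that affects subproblem $i$. Set $U_j:=\sum_i\pi_i(c_i^\top x^{RMP}_{ij}+\overline\theta_{ij})$ and $U_j^*:=\min(U^*_{j-1},U_j)$. 6. Dynamic level adjustment: $I^P_j:=\hat L_{j-1}-T_j$, $I^A_j:=\hat L_{j-1}-\hat L_j$, $r:=I^A_j/I^P_j$. If $I^A_j>0$ and $I^P_j>0$: set $\gamma_{j+1}:=1-\omega(1-\gamma_j)$ if $r\le\underline P$, and $\gamma_{j+1}:=\omega\gamma_j$ if $r>\overline P$. In all other cases (including when these quantities are undefined) $\gamma$ is carried over unchanged. Stop when $U_j^*-L_j^*\le\epsilon$. The solution obtained is the point $\mathbf x_k^{RMP}$ with $U_k=U_j^*$.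
   Formalization: The inner loop of each iteration reached (and each solver call) is assumed to finish: as stated, step 4 can repeat forever when the exact value equals the lower bound but lies below the upper bound, so the Algorithm need not converge; finiteness is proved for the number of outer iterations. *)

theory Defs
  imports "HOL-Analysis.Analysis"
begin

section \<open>Multi-horizon stochastic programs\<close>

text \<open>
  The nodes \<open>'i\<close> form the scenario tree. The decision vectors \<open>x\<^sub>i\<close> of the nodes may have different
  dimensions, so the variables of all nodes are collected in one vector \<open>real^'v\<close>, in which
  \<open>vars i\<close> are the coordinates belonging to node \<open>i\<close>; in the same way, \<open>rows i\<close> are the rows of
  the constraint system of node \<open>i\<close>. The types \<open>'o\<close>, \<open>'q\<close>, \<open>'y\<close>, \<open>'m\<close> index the coordinates of
  \<open>x\<^sup>O\<^sub>i\<close>, \<open>q\<^sub>i\<close>, \<open>y\<^sub>i\<close> and the rows of the subproblem, which are common to all nodes.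
  Bounds are extended reals since they may be absent.
\<close>

record ('i, 'v::finite, 'r::finite, 'o::finite, 'q::finite, 'y::finite, 'm::finite) mhsp =
  root_node :: 'i
  anc :: "'i \<Rightarrow> 'i"
  prob :: "'i \<Rightarrow> real"
  vars :: "'i \<Rightarrow> 'v set"
  rows :: "'i \<Rightarrow> 'r set"
  cost :: "'i \<Rightarrow> real^'v"
  TI :: "'i \<Rightarrow> real^'v^'r"
  WI :: "'i \<Rightarrow> real^'v^'r"
  hI :: "'i \<Rightarrow> real^'r"
  lb :: "'v \<Rightarrow> ereal"
  ub :: "'v \<Rightarrow> ereal"
  int_vars :: "'v set"
  op_var :: "'i \<Rightarrow> 'o \<Rightarrow> 'v"
  qvec :: "'i \<Rightarrow> real^'q"
  Qm :: "real^'y^'q"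
  TO :: "real^'o^'m"
  WO :: "real^'y^'m"
  hO :: "real^'m"
  ylb :: "'y \<Rightarrow> ereal"
  yub :: "'y \<Rightarrow> ereal"

definition stage :: "('i, 'v::finite, 'r::finite, 'o::finite, 'q::finite, 'y::finite, 'm::finite) mhsp \<Rightarrow> 'i \<Rightarrow> nat"
  where "stage P i = (LEAST n. (anc P ^^ n) i = root_node P)"

definition scenario_tree :: "('i::finite, 'v::finite, 'r::finite, 'o::finite, 'q::finite, 'y::finite, 'm::finite) mhsp \<Rightarrow> bool"
  where "scenario_tree P \<longleftrightarrow>
    (\<forall>i. \<exists>n. (anc P ^^ n) i = root_node P) \<and>
    (\<forall>i. 0 \<le> prob P i) \<and>
    (\<forall>s \<in> range (stage P). (\<Sum>i | stage P i = s. prob P i) = 1)"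

definition well_formed :: "('i::finite, 'v::finite, 'r::finite, 'o::finite, 'q::finite, 'y::finite, 'm::finite) mhsp \<Rightarrow> bool"
  where "well_formed P \<longleftrightarrow>
    scenario_tree P \<and>
    disjoint_family (vars P) \<and> (\<Union>i. vars P i) = UNIV \<and>
    (\<forall>i. inj (op_var P i) \<and> range (op_var P i) \<subseteq> vars P i)"

text \<open>\<open>x\<^sub>i\<close>, padded with zeros outside \<open>vars i\<close>: the other columns of the matrices and entries of
  the cost vectors are thus immaterial.\<close>

definition xpart :: "('i, 'v::finite, 'r::finite, 'o::finite, 'q::finite, 'y::finite, 'm::finite) mhsp
    \<Rightarrow> real^'v \<Rightarrow> 'i \<Rightarrow> real^'v"
  where "xpart P x i = (\<chi> v. if v \<in> vars P i then x $ v else 0)"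

definition xO :: "('i, 'v::finite, 'r::finite, 'o::finite, 'q::finite, 'y::finite, 'm::finite) mhsp
    \<Rightarrow> real^'v \<Rightarrow> 'i \<Rightarrow> real^'o"
  where "xO P x i = (\<chi> k. x $ op_var P i k)"

definition bounds_set :: "('i, 'v::finite, 'r::finite, 'o::finite, 'q::finite, 'y::finite, 'm::finite) mhsp
    \<Rightarrow> (real^'v) set"
  where "bounds_set P = {x. \<forall>v. lb P v \<le> ereal (x $ v) \<and> ereal (x $ v) \<le> ub P v}"

definition X_set :: "('i, 'v::finite, 'r::finite, 'o::finite, 'q::finite, 'y::finite, 'm::finite) mhsp
    \<Rightarrow> (real^'v) set"
  where "X_set P = {x \<in> bounds_set P. \<forall>v \<in> int_vars P. x $ v \<in> \<int>}"

definition strategic_constraints :: "('i, 'v::finite, 'r::finite, 'o::finite, 'q::finite, 'y::finite, 'm::finite) mhsp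
    \<Rightarrow> real^'v \<Rightarrow> bool"
  where "strategic_constraints P x \<longleftrightarrow>
    (\<forall>i. i \<noteq> root_node P \<longrightarrow> (\<forall>r \<in> rows P i.
        (TI P (anc P i) *v xpart P x (anc P i) + WI P i *v xpart P x i) $ r \<le> hI P i $ r)) \<and>
    (\<forall>r \<in> rows P (root_node P).
        (WI P (root_node P) *v xpart P x (root_node P)) $ r \<le> hI P (root_node P) $ r)"

definition feasible :: "('i, 'v::finite, 'r::finite, 'o::finite, 'q::finite, 'y::finite, 'm::finite) mhsp
    \<Rightarrow> (real^'v) set"
  where "feasible P = {x \<in> X_set P. strategic_constraints P x}"

definition Y_set :: "('i, 'v::finite, 'r::finite, 'o::finite, 'q::finite, 'y::finite, 'm::finite) mhsp
    \<Rightarrow> (real^'y) set"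
  where "Y_set P = {y. \<forall>k. ylb P k \<le> ereal (y $ k) \<and> ereal (y $ k) \<le> yub P k}"

text \<open>The value of the linear program, with the usual values \<open>\<infinity>\<close> if it is infeasible and \<open>-\<infinity>\<close> if it
  is unbounded; if the value is finite, it is attained.\<close>

definition gval :: "('i, 'v::finite, 'r::finite, 'o::finite, 'q::finite, 'y::finite, 'm::finite) mhsp
    \<Rightarrow> real^'o \<Rightarrow> real^'q \<Rightarrow> ereal"
  where "gval P x q =
    (INF y \<in> {y \<in> Y_set P. TO P *v x + WO P *v y \<le> hO P}. ereal (q \<bullet> (Qm P *v y)))"

definition objective :: "('i::finite, 'v::finite, 'r::finite, 'o::finite, 'q::finite, 'y::finite, 'm::finite) mhsp
    \<Rightarrow> real^'v \<Rightarrow> ereal"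
  where "objective P x =
    (\<Sum>i\<in>UNIV. ereal (prob P i) * (ereal (cost P i \<bullet> xpart P x i) + gval P (xO P x i) (qvec P i)))"

definition optimal_value :: "('i::finite, 'v::finite, 'r::finite, 'o::finite, 'q::finite, 'y::finite, 'm::finite) mhsp
    \<Rightarrow> ereal"
  where "optimal_value P = (INF x \<in> feasible P. objective P x)"

definition eps_optimal :: "('i::finite, 'v::finite, 'r::finite, 'o::finite, 'q::finite, 'y::finite, 'm::finite) mhsp
    \<Rightarrow> real \<Rightarrow> real^'v \<Rightarrow> bool"
  where "eps_optimal P e x \<longleftrightarrow> x \<in> feasible P \<and> objective P x \<le> optimal_value P + ereal e"

text \<open>Convexity and concavity of the extended-real-valued function are convexity of the epigraph and
  of the hypograph.\<close>

definition standing_condition :: "('i, 'v::finite, 'r::finite, 'o::finite, 'q::finite, 'y::finite, 'm::finite) mhsp \<Rightarrow> bool"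
  where "standing_condition P \<longleftrightarrow>
    (\<forall>q. convex {(x, r::real). gval P x q \<le> ereal r}) \<and>
    (\<forall>x. convex {(q, r::real). ereal r \<le> gval P x q}) \<and>
    (\<forall>q. antimono (\<lambda>x. gval P x q)) \<and>
    (\<forall>x. mono (gval P x))"


section \<open>Exact solutions and adaptive oracles\<close>

record ('o::finite, 'q::finite) entry =
  at_x :: "real^'o"
  at_q :: "real^'q"
  etheta :: real
  elam :: "real^'o"
  ephi :: "real^'q"

definition exact_solution :: "('i, 'v::finite, 'r::finite, 'o::finite, 'q::finite, 'y::finite, 'm::finite) mhsp
    \<Rightarrow> ('o, 'q) entry \<Rightarrow> bool"
  where "exact_solution P s \<longleftrightarrow>
    gval P (at_x s) (at_q s) = ereal (etheta s) \<and>
    (\<forall>x. ereal (etheta s + elam s \<bullet> (x - at_x s)) \<le> gval P x (at_q s)) \<and>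
    (\<forall>q. gval P (at_x s) q \<le> ereal (etheta s + ephi s \<bullet> (q - at_q s)))"

definition simplex_weights :: "'s set \<Rightarrow> ('s \<Rightarrow> real) \<Rightarrow> bool"
  where "simplex_weights S \<mu> \<longleftrightarrow> (\<forall>s\<in>S. 0 \<le> \<mu> s) \<and> (\<Sum>s\<in>S. \<mu> s) = 1"

text \<open>The oracles are relations: \<open>lower_oracle S x q \<theta> l\<close> says that the call at \<open>(x, q)\<close> may return
  \<open>\<theta>\<close> and \<open>l\<close>, where \<open>l\<close> depends on the choice of the optimal weights.\<close>

definition lower_oracle :: "('o::finite, 'q::finite) entry set \<Rightarrow> real^'o \<Rightarrow> real^'q \<Rightarrow> real \<Rightarrow> real^'o \<Rightarrow> bool"
  where "lower_oracle S x q \<theta> l \<longleftrightarrow>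
    (\<exists>\<mu>. is_arg_max (\<lambda>\<mu>. \<Sum>s\<in>S. \<mu> s * (etheta s + elam s \<bullet> (x - at_x s)))
            (\<lambda>\<mu>. simplex_weights S \<mu> \<and> (\<Sum>s\<in>S. \<mu> s *\<^sub>R at_q s) \<le> q) \<mu> \<and>
         \<theta> = (\<Sum>s\<in>S. \<mu> s * (etheta s + elam s \<bullet> (x - at_x s))) \<and>
         l = (\<Sum>s\<in>S. \<mu> s *\<^sub>R elam s))"

definition upper_oracle :: "('o::finite, 'q::finite) entry set \<Rightarrow> real^'o \<Rightarrow> real^'q \<Rightarrow> real \<Rightarrow> bool"
  where "upper_oracle S x q \<theta> \<longleftrightarrow>
    (\<exists>\<mu>. is_arg_min (\<lambda>\<mu>. \<Sum>s\<in>S. \<mu> s * (etheta s + ephi s \<bullet> (q - at_q s)))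
            (\<lambda>\<mu>. simplex_weights S \<mu> \<and> (\<Sum>s\<in>S. \<mu> s *\<^sub>R at_x s) \<le> x) \<mu> \<and>
         \<theta> = (\<Sum>s\<in>S. \<mu> s * (etheta s + ephi s \<bullet> (q - at_q s))))"


section \<open>The algorithm\<close>

record ('o::finite, 'q::finite) parameters =
  tol :: real
  gamma0 :: real
  beta_low :: real
  eps0 :: real
  omega :: real
  P_low :: real
  P_up :: real
  x_low :: "real^'o"
  q_low :: "real^'q"

text \<open>\<open>beta_low\<close> has to be a valid lower bound for the subproblem values, since otherwise the reduced
  master problem is not a relaxation.\<close>

definition valid_parameters :: "('i, 'v::finite, 'r::finite, 'o::finite, 'q::finite, 'y::finite, 'm::finite) mhsp
    \<Rightarrow> ('o, 'q) parameters \<Rightarrow> bool"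
  where "valid_parameters P A \<longleftrightarrow>
    0 \<le> tol A \<and>
    gamma0 A \<in> {0<..<1} \<and>
    omega A \<in> {0<..<1} \<and>
    P_low A \<in> {0<..<1} \<and>
    P_up A \<in> {P_low A<..<1} \<and>
    (\<forall>x \<in> feasible P. \<forall>i. ereal (beta_low A) \<le> gval P (xO P x i) (qvec P i)) \<and>
    (\<forall>i. q_low A \<le> qvec P i)"

text \<open>
  A run records the values that the algorithm computes in iteration \<open>j\<close>. The quantities that change
  during the inner loop carry a second index \<open>p\<close>: \<open>Sset R j p\<close>, \<open>xi R j p\<close>, \<open>low R j p\<close>,
  \<open>lam R j p\<close>, \<open>up R j p\<close> are the values after \<open>p\<close> passes through the inner loop, whereas
  \<open>ihat R j p\<close> and \<open>sol R j p\<close> are the node selected and the exact solution obtained in pass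
  \<open>p + 1\<close>. The inner loop is left after \<open>passes R j\<close> passes. Index \<open>j = 0\<close> is the initialisation,
  and fields at indices where the algorithm computes nothing are arbitrary.
\<close>

record ('i, 'v::finite, 'o::finite, 'q::finite) run =
  xRMP :: "nat \<Rightarrow> real^'v"
  beta :: "nat \<Rightarrow> 'i \<Rightarrow> real"
  Lstar :: "nat \<Rightarrow> real"
  xCP :: "nat \<Rightarrow> real^'v"
  target :: "nat \<Rightarrow> real"
  xhat :: "nat \<Rightarrow> real^'v"
  passes :: "nat \<Rightarrow> nat"
  Sset :: "nat \<Rightarrow> nat \<Rightarrow> ('o, 'q) entry set"
  xi :: "nat \<Rightarrow> nat \<Rightarrow> bool"
  low :: "nat \<Rightarrow> nat \<Rightarrow> 'i \<Rightarrow> real"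
  lam :: "nat \<Rightarrow> nat \<Rightarrow> 'i \<Rightarrow> real^'o"
  up :: "nat \<Rightarrow> nat \<Rightarrow> 'i \<Rightarrow> real"
  ihat :: "nat \<Rightarrow> nat \<Rightarrow> 'i"
  sol :: "nat \<Rightarrow> nat \<Rightarrow> ('o, 'q) entry"
  upRMP :: "nat \<Rightarrow> 'i \<Rightarrow> real"
  Ubd :: "nat \<Rightarrow> real"
  Ustar :: "nat \<Rightarrow> ereal"
  gam :: "nat \<Rightarrow> real"

definition value_with :: "('i::finite, 'v::finite, 'r::finite, 'o::finite, 'q::finite, 'y::finite, 'm::finite) mhsp
    \<Rightarrow> real^'v \<Rightarrow> ('i \<Rightarrow> real) \<Rightarrow> real"
  where "value_with P x b = (\<Sum>i\<in>UNIV. prob P i * (cost P i \<bullet> xpart P x i + b i))"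

definition Lhat :: "('i::finite, 'v::finite, 'r::finite, 'o::finite, 'q::finite, 'y::finite, 'm::finite) mhsp
    \<Rightarrow> ('i, 'v, 'o, 'q) run \<Rightarrow> nat \<Rightarrow> nat \<Rightarrow> real"
  where "Lhat P R j p = value_with P (xhat R j) (low R j p)"

definition Uhat :: "('i::finite, 'v::finite, 'r::finite, 'o::finite, 'q::finite, 'y::finite, 'm::finite) mhsp
    \<Rightarrow> ('i, 'v, 'o, 'q) run \<Rightarrow> nat \<Rightarrow> nat \<Rightarrow> real"
  where "Uhat P R j p = value_with P (xhat R j) (up R j p)"

definition cuts_hold :: "('i, 'v::finite, 'r::finite, 'o::finite, 'q::finite, 'y::finite, 'm::finite) mhsp
    \<Rightarrow> ('o, 'q) parameters \<Rightarrow> ('i, 'v, 'o, 'q) run \<Rightarrow> nat \<Rightarrow> real^'v \<Rightarrow> ('i \<Rightarrow> real) \<Rightarrow> bool"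
  where "cuts_hold P A R j x b \<longleftrightarrow>
    (\<forall>i. beta_low A \<le> b i) \<and>
    (\<forall>i. \<forall>k \<in> {1..<j}.
       low R k (passes R k) i + lam R k (passes R k) i \<bullet> (xO P x i - xO P (xhat R k) i) \<le> b i)"

definition RMP_solution :: "('i::finite, 'v::finite, 'r::finite, 'o::finite, 'q::finite, 'y::finite, 'm::finite) mhsp
    \<Rightarrow> ('o, 'q) parameters \<Rightarrow> ('i, 'v, 'o, 'q) run \<Rightarrow> nat \<Rightarrow> real^'v \<Rightarrow> ('i \<Rightarrow> real) \<Rightarrow> bool"
  where "RMP_solution P A R j x b \<longleftrightarrow>
    is_arg_min (\<lambda>(x, b). value_with P x b)
      (\<lambda>(x, b). x \<in> feasible P \<and> cuts_hold P A R j x b) (x, b)"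

definition CP_point :: "('i::finite, 'v::finite, 'r::finite, 'o::finite, 'q::finite, 'y::finite, 'm::finite) mhsp
    \<Rightarrow> ('o, 'q) parameters \<Rightarrow> ('i, 'v, 'o, 'q) run \<Rightarrow> nat \<Rightarrow> real \<Rightarrow> real^'v \<Rightarrow> bool"
  where "CP_point P A R j T x \<longleftrightarrow>
    (\<exists>b. x \<in> bounds_set P \<and> strategic_constraints P x \<and> cuts_hold P A R j x b \<and>
         value_with P x b \<le> T)"

definition oracles_called :: "('i, 'v::finite, 'r::finite, 'o::finite, 'q::finite, 'y::finite, 'm::finite) mhsp
    \<Rightarrow> ('i, 'v, 'o, 'q) run \<Rightarrow> nat \<Rightarrow> nat \<Rightarrow> bool"
  where "oracles_called P R j p \<longleftrightarrow>
    (\<forall>i. lower_oracle (Sset R j p) (xO P (xhat R j) i) (qvec P i) (low R j p i) (lam R j p i) \<and>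
         upper_oracle (Sset R j p) (xO P (xhat R j) i) (qvec P i) (up R j p i))"

definition gap :: "('i, 'v::finite, 'r::finite, 'o::finite, 'q::finite, 'y::finite, 'm::finite) mhsp
    \<Rightarrow> ('i, 'v, 'o, 'q) run \<Rightarrow> nat \<Rightarrow> nat \<Rightarrow> 'i \<Rightarrow> real"
  where "gap P R j p i = prob P i * (up R j p i - low R j p i)"

definition no_gap :: "('i::finite, 'v::finite, 'r::finite, 'o::finite, 'q::finite, 'y::finite, 'm::finite) mhsp
    \<Rightarrow> ('i, 'v, 'o, 'q) run \<Rightarrow> nat \<Rightarrow> nat \<Rightarrow> bool"
  where "no_gap P R j p \<longleftrightarrow> Max (range (gap P R j p)) = 0"

text \<open>For \<open>j = 1\<close> the first inequality holds because \<open>Ustar R 0 = \<infinity>\<close>.\<close>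

definition until_condition :: "('i::finite, 'v::finite, 'r::finite, 'o::finite, 'q::finite, 'y::finite, 'm::finite) mhsp
    \<Rightarrow> ('i, 'v, 'o, 'q) run \<Rightarrow> nat \<Rightarrow> nat \<Rightarrow> bool"
  where "until_condition P R j p \<longleftrightarrow>
    (ereal (Uhat P R j p - Lhat P R j p) \<le> Ustar R (j - 1) - ereal (Lstar R (j - 1)) \<and> xi R j p) \<or>
    Ustar R (j - 1) \<le> ereal (Lhat P R j p)"

definition inner_pass :: "('i::finite, 'v::finite, 'r::finite, 'o::finite, 'q::finite, 'y::finite, 'm::finite) mhsp
    \<Rightarrow> ('i, 'v, 'o, 'q) run \<Rightarrow> nat \<Rightarrow> nat \<Rightarrow> bool"
  where "inner_pass P R j p \<longleftrightarrow>
    is_arg_max (gap P R j p) (\<lambda>_. True) (ihat R j p) \<and>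
    exact_solution P (sol R j p) \<and>
    at_x (sol R j p) = xO P (xhat R j) (ihat R j p) \<and>
    at_q (sol R j p) = qvec P (ihat R j p) \<and>
    (if low R j p (ihat R j p) < etheta (sol R j p)
     then xi R j (Suc p) \<and> Sset R j (Suc p) = insert (sol R j p) (Sset R j p)
     else xi R j (Suc p) = xi R j p \<and> Sset R j (Suc p) = Sset R j p) \<and>
    oracles_called P R j (Suc p)"

text \<open>
  A completed inner loop. A pass in which the exact solution does not exceed the lower bound leaves
  the collection unchanged, so an inner loop can also repeat such a pass forever; then
  iteration \<open>j\<close> is never completed.
\<close>

definition inner_loop :: "('i::finite, 'v::finite, 'r::finite, 'o::finite, 'q::finite, 'y::finite, 'm::finite) mhsp
    \<Rightarrow> ('i, 'v, 'o, 'q) run \<Rightarrow> nat \<Rightarrow> bool"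
  where "inner_loop P R j \<longleftrightarrow>
    (\<forall>p < passes R j. \<not> no_gap P R j p \<and> inner_pass P R j p) \<and>
    (\<forall>p \<in> {1..<passes R j}. \<not> until_condition P R j p) \<and>
    (no_gap P R j (passes R j) \<or> 1 \<le> passes R j \<and> until_condition P R j (passes R j))"

definition initialised :: "('i, 'v::finite, 'r::finite, 'o::finite, 'q::finite, 'y::finite, 'm::finite) mhsp
    \<Rightarrow> ('o, 'q) parameters \<Rightarrow> ('i, 'v, 'o, 'q) run \<Rightarrow> bool"
  where "initialised P A R \<longleftrightarrow>
    Ustar R 0 = \<infinity> \<and>
    passes R 0 = 0 \<and>
    \<not> xi R 0 0 \<and>
    xCP R 0 = 0 \<and>
    gam R 0 = gamma0 A \<and> gam R 1 = gamma0 A \<and>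
    (\<exists>s. exact_solution P s \<and> at_x s = x_low A \<and> at_q s = q_low A \<and> Sset R 0 0 = {s})"

definition CP_solved :: "('i, 'v::finite, 'o::finite, 'q::finite) run \<Rightarrow> nat \<Rightarrow> bool"
  where "CP_solved R j \<longleftrightarrow> 2 \<le> j \<and> xi R (j - 1) (passes R (j - 1))"

text \<open>The bounds of the last pass are undefined if the inner loop was left before its first pass, and
  the target is undefined if no centred point problem was solved.\<close>

definition next_gamma :: "('i::finite, 'v::finite, 'r::finite, 'o::finite, 'q::finite, 'y::finite, 'm::finite) mhsp
    \<Rightarrow> ('o, 'q) parameters \<Rightarrow> ('i, 'v, 'o, 'q) run \<Rightarrow> nat \<Rightarrow> real"
  where "next_gamma P A R j =
    (let L' = Lhat P R (j - 1) (passes R (j - 1));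
         IP = L' - target R j;
         IA = L' - Lhat P R j (passes R j);
         r = IA / IP
     in if CP_solved R j \<and> 1 \<le> passes R (j - 1) \<and> 1 \<le> passes R j \<and> 0 < IA \<and> 0 < IP
        then if r \<le> P_low A then 1 - omega A * (1 - gam R j)
             else if P_up A < r then omega A * gam R j
             else gam R j
        else gam R j)"

definition iteration :: "('i::finite, 'v::finite, 'r::finite, 'o::finite, 'q::finite, 'y::finite, 'm::finite) mhsp
    \<Rightarrow> ('o, 'q) parameters \<Rightarrow> ('i, 'v, 'o, 'q) run \<Rightarrow> nat \<Rightarrow> bool"
  where "iteration P A R j \<longleftrightarrow>
    RMP_solution P A R j (xRMP R j) (beta R j) \<and>
    Lstar R j = value_with P (xRMP R j) (beta R j) \<and>
    (if CP_solved R j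
     then target R j = Lstar R j + gam R j * (real_of_ereal (Ustar R (j - 1)) - Lstar R j) \<and>
          CP_point P A R j (target R j) (xCP R j) \<and>
          xhat R j = (if norm (xCP R j - xCP R (j - 1)) \<le> eps0 A then xCP R j else xRMP R j)
     else xCP R j = xCP R (j - 1) \<and> xhat R j = xRMP R j) \<and>
    Sset R j 0 = Sset R (j - 1) (passes R (j - 1)) \<and>
    \<not> xi R j 0 \<and>
    oracles_called P R j 0 \<and>
    inner_loop P R j \<and>
    (\<forall>i. upper_oracle (Sset R j (passes R j)) (xO P (xRMP R j) i) (qvec P i) (upRMP R j i)) \<and>
    Ubd R j = value_with P (xRMP R j) (upRMP R j) \<and>
    Ustar R j = min (Ustar R (j - 1)) (ereal (Ubd R j)) \<and>
    gam R (j + 1) = next_gamma P A R j"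

definition stops :: "('o::finite, 'q::finite) parameters \<Rightarrow> ('i, 'v::finite, 'o, 'q) run \<Rightarrow> nat \<Rightarrow> bool"
  where "stops A R j \<longleftrightarrow> Ustar R j - ereal (Lstar R j) \<le> ereal (tol A)"

definition reached :: "('o::finite, 'q::finite) parameters \<Rightarrow> ('i, 'v::finite, 'o, 'q) run \<Rightarrow> nat \<Rightarrow> bool"
  where "reached A R j \<longleftrightarrow> 1 \<le> j \<and> (\<forall>k \<in> {1..<j}. \<not> stops A R k)"

text \<open>The algorithm keeps performing iterations as long as it has not stopped. The last conjunct
  is the requirement on the special point \<open>x_low\<close>.\<close>

definition execution :: "('i::finite, 'v::finite, 'r::finite, 'o::finite, 'q::finite, 'y::finite, 'm::finite) mhsp
    \<Rightarrow> ('o, 'q) parameters \<Rightarrow> ('i, 'v, 'o, 'q) run \<Rightarrow> bool"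
  where "execution P A R \<longleftrightarrow>
    initialised P A R \<and>
    (\<forall>j. reached A R j \<longrightarrow> iteration P A R j) \<and>
    (\<forall>j i. reached A R j \<longrightarrow> x_low A \<le> xO P (xhat R j) i \<and> x_low A \<le> xO P (xRMP R j) i)"

end

theory Submission
  imports Defs
begin

text \<open>
  Correctness at termination is a matter of valid bounds. Since \<open>g\<close> is concave and increasing in \<open>q\<close>,
  the lower oracle, which averages cuts taken at other values of \<open>q\<close>, returns a valid cut
  (\<open>lower_oracle_cut_valid\<close>). The reduced master problem is therefore a relaxation and
  \<open>Lstar\<close> is a lower bound for the optimal value. Dually, convexity and monotonicity in \<open>x\<close> make
  \<open>Ubd k\<close> an upper bound for the objective at \<open>xRMP k\<close> (\<open>upper_oracle_valid\<close>). A gap of at most the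
  tolerance then certifies the incumbent.

  Finiteness comes from pigeonhole arguments on the faces of polyhedra. The subgradients returned at
  a point are arbitrary, so the number of possible cuts need not be finite. What is finite is the
  number of faces: if an affine function is nonnegative on a polyhedron and vanishes at one point of
  the relative interior of a face, it vanishes on the whole face. Hence a cut is exact on the whole
  face on which it was made, and each face can contribute only one useful cut. Two points lie in the
  relative interior of the same face iff the same inequalities are active at both, so faces are
  represented by sets of active inequalities, and the principle takes the elementary form of
  \<open>step_away_within_face\<close>: from either point one can make a short step away from the other.

  This is used for two families of polyhedra. First, for the graph \<open>{(x, y)}\<close> of feasible points of the
  linear program: an exact solution that improves on the lower oracle must have its optimal \<open>(x, y)\<close> on a
  face not visited before by the same node (\<open>exact_cut_tight_on_face\<close>), so only
  finitely many iterations enlarge the collection of exact solutions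
  (\<open>finitely_many_improving_iterations\<close>). From then on the collection \<open>S\<close> is constant and \<open>\<xi>\<close> is
  \<open>0\<close>, so no centred points are used, and the algorithm is Kelley's cutting plane method for
  the polyhedral lower oracle of \<open>S\<close>. Secondly, therefore, for the polytope of oracle weights: when
  for every node the weights at \<open>j\<close> lie on the same face as those at some \<open>k < j\<close>, the cuts of
  iteration \<open>k\<close> are already tight at iteration \<open>j\<close> (\<open>oracle_weights_optimal_on_face\<close>), so
  \<open>Lhat j \<le> Lstar j\<close>. With \<open>\<xi> = 0\<close> the inner loop can only be left because the oracles agree or
  because \<open>Lhat j\<close> reaches the incumbent, and in both cases \<open>Ustar j \<le> Lhat j \<le> Lstar j\<close>, so that
  the algorithm stops.
\<close>

section \<open>Faces of finite systems of affine inequalities\<close>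

text \<open>
  A linear function plus a constant, in the form in which affinity is needed: for moving a point along
  the line through two given points.
\<close>

definition affine_fun :: "('z::real_vector \<Rightarrow> real) \<Rightarrow> bool"
  where "affine_fun f \<longleftrightarrow> (\<forall>a b t. f (a + t *\<^sub>R (b - a)) = f a + t * (f b - f a))"

lemma affine_funD: "affine_fun f \<Longrightarrow> f (a + t *\<^sub>R (b - a)) = f a + t * (f b - f a)"
  unfolding affine_fun_def by blast

text \<open>
  The numbers \<open>u k\<close> and \<open>w k\<close> are the slacks of inequality \<open>k\<close> at two points \<open>a\<close> and \<open>b\<close> with the same
  active inequalities. Along the line through \<open>a\<close> and \<open>b\<close> the active slacks stay zero and the
  others stay positive near \<open>a\<close>, so \<open>a - t(b - a)\<close> satisfies all inequalities for small \<open>t > 0\<close>.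
  An affine function with a minimum over the system at \<open>a\<close> is hence constant on the line.
\<close>

lemma step_away_within_face:
  fixes u w :: "'k \<Rightarrow> real"
  assumes "finite K"
    and "\<And>k. k \<in> K \<Longrightarrow> 0 \<le> u k" "\<And>k. k \<in> K \<Longrightarrow> 0 \<le> w k"
    and "\<And>k. k \<in> K \<Longrightarrow> u k = 0 \<longleftrightarrow> w k = 0"
  shows "\<exists>t>0. \<forall>k\<in>K. 0 \<le> u k - t * (w k - u k)"
proof -
  have "\<forall>\<^sub>F t in at_right (0::real). 0 \<le> u k - t * (w k - u k)" if k: "k \<in> K" for k
  proof (cases "u k = 0")
    case True
    then show ?thesis using assms(4)[OF k] by simp
  next
    case False
    then have "0 < u k" using assms(2)[OF k] by simp
    moreover have "((\<lambda>t. u k - t * (w k - u k)) \<longlongrightarrow> u k - 0 * (w k - u k)) (at_right 0)"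
      by (intro tendsto_intros)
    ultimately have "\<forall>\<^sub>F t in at_right 0. 0 < u k - t * (w k - u k)"
      by (intro order_tendstoD(1)) auto
    then show ?thesis by (rule eventually_mono) simp
  qed
  then have "\<forall>\<^sub>F t in at_right (0::real). \<forall>k\<in>K. 0 \<le> u k - t * (w k - u k)"
    using assms(1) by (simp add: eventually_ball_finite)
  moreover have "\<forall>\<^sub>F t in at_right (0::real). 0 < t"
    by (simp add: eventually_at_right_less)
  ultimately have "\<forall>\<^sub>F t in at_right (0::real). 0 < t \<and> (\<forall>k\<in>K. 0 \<le> u k - t * (w k - u k))"
    by eventually_elim blast
  then show ?thesis
    using eventually_happens'[of "at_right (0::real)"] by force
qed

text \<open>
  The minimum of a linear program is attained because only finitely many candidates for it exist:
  from any feasible point one can pass to an extremal one, whose active set cannot be enlarged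
  without increasing the objective, and the objective value of an extremal point is determined by
  its active set. Indeed, moving from an extremal point towards a better one with the same active set
  would either meet a further inequality, giving a larger active set, or decrease the
  objective without bound.
\<close>

lemma affine_fun_attains_minimum:
  fixes slack :: "'k::finite \<Rightarrow> 'z::real_vector \<Rightarrow> real" and h :: "'z \<Rightarrow> real"
  assumes aff: "\<And>k. affine_fun (slack k)" "affine_fun h"
    and ne: "\<forall>k. 0 \<le> slack k z0"
    and bdd: "\<And>z. \<forall>k. 0 \<le> slack k z \<Longrightarrow> m \<le> h z"
  shows "\<exists>z. (\<forall>k. 0 \<le> slack k z) \<and> (\<forall>z'. (\<forall>k. 0 \<le> slack k z') \<longrightarrow> h z \<le> h z')"
proof -
  define F where "F = {z. \<forall>k. 0 \<le> slack k z}"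
  define act where "act z = {k. slack k z = 0}" for z
  define extremal where
    "extremal z \<longleftrightarrow> z \<in> F \<and> (\<forall>z'\<in>F. h z' \<le> h z \<longrightarrow> \<not> act z \<subset> act z')" for z
  \<comment> \<open>Choose a point with the largest number of active inequalities among those not worse than \<open>z\<close>.\<close>
  have below: "\<exists>e. extremal e \<and> h e \<le> h z" if z: "z \<in> F" for z
  proof -
    define N where "N = card ` act ` {z'\<in>F. h z' \<le> h z}"
    have fin: "finite N"
      unfolding N_def by simp
    have "N \<noteq> {}" using z unfolding N_def by auto
    then have "Max N \<in> N" using fin by simp
    then obtain e where e: "e \<in> F" "h e \<le> h z" "card (act e) = Max N"
      unfolding N_def by auto
    have "\<not> act e \<subset> act z'" if "z' \<in> F" "h z' \<le> h e" for z'
    proof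
      assume "act e \<subset> act z'"
      then have "card (act e) < card (act z')" by (simp add: psubset_card_mono)
      moreover have "card (act z') \<in> N" using that e(2) unfolding N_def by force
      ultimately show False using Max_ge[OF fin] e(3) by fastforce
    qed
    then show ?thesis using e unfolding extremal_def by blast
  qed
  have same_value: "h a \<le> h b" if a: "extremal a" and b: "b \<in> F" and ab: "act a = act b" for a b
  proof (rule ccontr)
    assume "\<not> h a \<le> h b"
    then have hlt: "h b < h a" by simp
    have aF: "a \<in> F" using a unfolding extremal_def by blast
    define D where "D = {k. slack k b < slack k a}"
    show False
    proof (cases "D = {}")
      case True
      \<comment> \<open>The step length at which the objective would be \<open>m - 1\<close>, below its lower bound.\<close>
      define t where "t = (h a - m + 1) / (h a - h b)"
      have ma: "m \<le> h a" using bdd[of a] aF unfolding F_def by simp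
      have tpos: "0 \<le> t" unfolding t_def using hlt ma by simp
      have "0 \<le> slack k (a + t *\<^sub>R (b - a))" for k
      proof -
        have "slack k a \<le> slack k b" using True unfolding D_def by (auto simp: not_less)
        moreover have "0 \<le> slack k a" using aF unfolding F_def by simp
        ultimately show ?thesis using tpos by (simp add: affine_funD[OF aff(1)])
      qed
      then have "m \<le> h (a + t *\<^sub>R (b - a))" using bdd by blast
      also have "\<dots> = h a - t * (h a - h b)"
        unfolding affine_funD[OF aff(2)] by (simp add: algebra_simps)
      also have "\<dots> = m - 1" unfolding t_def using hlt by simp
      finally show False by simp
    next
      case False
      \<comment> \<open>The ratio test: \<open>t\<close> is the step length at which the first further inequality \<open>k0\<close> becomes active.\<close>
      define ratio where "ratio k = slack k a / (slack k a - slack k b)" for k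
      define t where "t = Min (ratio ` D)"
      have "t \<in> ratio ` D" unfolding t_def using False by simp
      then obtain k0 where k0: "k0 \<in> D" "t = ratio k0" by blast
      have tle: "t \<le> ratio k" if "k \<in> D" for k unfolding t_def using that by simp
      have nonneg: "0 \<le> slack k a" "0 \<le> slack k b" for k
        using aF b unfolding F_def by simp_all
      have tpos: "0 \<le> t" unfolding k0(2) ratio_def using k0(1) nonneg unfolding D_def by simp
      define c where "c = a + t *\<^sub>R (b - a)"
      have sc: "slack k c = slack k a - t * (slack k a - slack k b)" for k
        unfolding c_def affine_funD[OF aff(1)] by (simp add: algebra_simps)
      have cF: "c \<in> F"
      proof -
        have "0 \<le> slack k c" for k
        proof (cases "k \<in> D")
          case True
          then show ?thesis
            using tle[OF True] unfolding sc D_def ratio_def by (simp add: field_simps)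
        next
          case False
          then have "t * (slack k a - slack k b) \<le> 0"
            using tpos unfolding D_def by (simp add: mult_nonneg_nonpos)
          then show ?thesis using nonneg(1)[of k] unfolding sc by simp
        qed
        then show ?thesis unfolding F_def by simp
      qed
      have "slack k0 c = 0"
        using k0 unfolding sc D_def ratio_def by simp
      moreover have "slack k0 a \<noteq> 0"
        using k0(1) nonneg(2)[of k0] unfolding D_def by simp
      moreover have "act a \<subseteq> act c"
      proof
        fix k assume "k \<in> act a"
        then have "slack k a = 0" "slack k b = 0" using ab unfolding act_def by auto
        then show "k \<in> act c" unfolding act_def sc by simp
      qed
      ultimately have "act a \<subset> act c" unfolding act_def by auto
      moreover have "h c \<le> h a"
      proof -
        have "h c = h a - t * (h a - h b)"
          unfolding c_def affine_funD[OF aff(2)] by (simp add: algebra_simps)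
        then show ?thesis using tpos hlt by simp
      qed
      ultimately show False using a cF unfolding extremal_def by blast
    qed
  qed
  \<comment> \<open>One extremal point per active set suffices, which leaves finitely many values \<open>V\<close>.\<close>
  define E where "E = {e. extremal e}"
  have inF: "e \<in> F" if "e \<in> E" for e using that unfolding E_def extremal_def by simp
  obtain rep where rep: "\<And>e. e \<in> E \<Longrightarrow> rep (act e) \<in> E \<and> act (rep (act e)) = act e"
    using that[of "\<lambda>A. SOME e. e \<in> E \<and> act e = A"] by (metis (mono_tags, lifting) someI_ex)
  have E_ne: "E \<noteq> {}" using below[of z0] ne unfolding E_def F_def by blast
  define V where "V = (h \<circ> rep) ` act ` E"
  have finV: "finite V" unfolding V_def by simp
  have "V \<noteq> {}" unfolding V_def using E_ne by simp
  then have "Min V \<in> V" using finV by simp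
  then obtain e where e: "e \<in> E" "h (rep (act e)) = Min V" unfolding V_def by auto
  define z where "z = rep (act e)"
  have zE: "z \<in> E" using rep[OF e(1)] unfolding z_def by simp
  have "h z \<le> h z'" if z': "z' \<in> F" for z'
  proof -
    obtain e' where e': "e' \<in> E" "h e' \<le> h z'"
      using below[OF z'] unfolding E_def by blast
    have "h z \<le> h (rep (act e'))"
      using e' e(2) Min_le[OF finV] unfolding z_def V_def by simp
    also have "\<dots> \<le> h e'"
      using same_value rep[OF e'(1)] e'(1) inF unfolding E_def by blast
    finally show ?thesis using e'(2) by simp
  qed
  then show ?thesis using inF[OF zE] unfolding F_def by blast
qed


section \<open>The subproblem as a linear program\<close>

definition sub_feasible :: "('i, 'v::finite, 'r::finite, 'o::finite, 'q::finite, 'y::finite, 'm::finite) mhsp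
    \<Rightarrow> (real^'o) \<times> (real^'y) \<Rightarrow> bool"
  where "sub_feasible P z \<longleftrightarrow> snd z \<in> Y_set P \<and> TO P *v fst z + WO P *v snd z \<le> hO P"

text \<open>
  The inequalities of the subproblem in the variables \<open>(x, y)\<close> jointly. An absent bound on \<open>y\<close>
  contributes the constant slack \<open>1\<close>: it is always satisfied and never active.
\<close>

definition sub_slack :: "('i, 'v::finite, 'r::finite, 'o::finite, 'q::finite, 'y::finite, 'm::finite) mhsp
    \<Rightarrow> 'm + 'y + 'y \<Rightarrow> (real^'o) \<times> (real^'y) \<Rightarrow> real"
  where "sub_slack P k z = (case k of
      Inl r \<Rightarrow> (hO P - TO P *v fst z - WO P *v snd z) $ r
    | Inr (Inl l) \<Rightarrow> if \<bar>ylb P l\<bar> = \<infinity> then 1 else snd z $ l - real_of_ereal (ylb P l)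
    | Inr (Inr l) \<Rightarrow> if \<bar>yub P l\<bar> = \<infinity> then 1 else real_of_ereal (yub P l) - snd z $ l)"

lemma affine_sub_slack: "affine_fun (sub_slack P k)"
proof -
  have "sub_slack P k (a + t *\<^sub>R (b - a)) = sub_slack P k a + t * (sub_slack P k b - sub_slack P k a)"
    for a b t
    by (cases k rule: sumE; (elim exE)?)
       (auto simp: sub_slack_def algebra_simps matrix_vector_right_distrib matrix_vector_mult_scaleR
          matrix_vector_mult_diff_distrib split: sum.split)
  then show ?thesis unfolding affine_fun_def by blast
qed

text \<open>
  Existence of a feasible point rules out the lower bound \<open>\<infinity>\<close> and the upper bound \<open>-\<infinity>\<close>, for which the
  constant slack would be wrong.
\<close>

lemma sub_feasible_slack:
  assumes "sub_feasible P z0"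
  shows "sub_feasible P z \<longleftrightarrow> (\<forall>k. 0 \<le> sub_slack P k z)"
proof -
  have bounds: "ylb P l \<le> ereal (snd z0 $ l)" "ereal (snd z0 $ l) \<le> yub P l" for l
    using assms unfolding sub_feasible_def Y_set_def by blast+
  have lb: "ylb P l \<noteq> \<infinity>" and ub: "yub P l \<noteq> -\<infinity>" for l
    using bounds[of l] by auto
  have 1: "ylb P l \<le> ereal (snd z $ l) \<longleftrightarrow> 0 \<le> sub_slack P (Inr (Inl l)) z" for l
    using lb[of l] by (cases "ylb P l") (auto simp: sub_slack_def)
  have 2: "ereal (snd z $ l) \<le> yub P l \<longleftrightarrow> 0 \<le> sub_slack P (Inr (Inr l)) z" for l
    using ub[of l] by (cases "yub P l") (auto simp: sub_slack_def)
  have 3: "(TO P *v fst z + WO P *v snd z) $ r \<le> hO P $ r \<longleftrightarrow> 0 \<le> sub_slack P (Inl r) z" for r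
    by (auto simp: sub_slack_def)
  have "sub_feasible P z \<longleftrightarrow> (\<forall>l. 0 \<le> sub_slack P (Inr (Inl l)) z \<and> 0 \<le> sub_slack P (Inr (Inr l)) z)
     \<and> (\<forall>r. 0 \<le> sub_slack P (Inl r) z)"
    unfolding sub_feasible_def Y_set_def less_eq_vec_def mem_Collect_eq 1 2 3 by blast
  then show ?thesis by (metis sumE)
qed

lemma gval_le: "sub_feasible P (x, y) \<Longrightarrow> gval P x q \<le> ereal (q \<bullet> (Qm P *v y))"
  unfolding gval_def sub_feasible_def by (auto intro!: INF_lower)

lemma gval_attained:
  fixes P :: "('i, 'v::finite, 'r::finite, 'o::finite, 'q::finite, 'y::finite, 'm::finite) mhsp"
  assumes g: "gval P x q = ereal \<theta>"
  shows "\<exists>y. sub_feasible P (x, y) \<and> q \<bullet> (Qm P *v y) = \<theta>"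
proof -
  define h where "h y = q \<bullet> (Qm P *v y)" for y
  have "\<exists>y0. sub_feasible P (x, y0)"
  proof (rule ccontr)
    assume "\<nexists>y0. sub_feasible P (x, y0)"
    then have empty: "{y \<in> Y_set P. TO P *v x + WO P *v y \<le> hO P} = {}"
      unfolding sub_feasible_def by auto
    show False using g unfolding gval_def empty by (simp add: top_ereal_def)
  qed
  then obtain y0 where y0: "sub_feasible P (x, y0)" ..
  note slack = sub_feasible_slack[OF y0]
  have "affine_fun (\<lambda>y. sub_slack P k (x, y))" for k
  proof -
    have "(x, a + t *\<^sub>R (b - a)) = (x, a) + t *\<^sub>R ((x, b) - (x, a))" for a b t by simp
    then show ?thesis
      using affine_funD[OF affine_sub_slack[of P k]] unfolding affine_fun_def by metis
  qed
  moreover have "affine_fun h"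
    unfolding affine_fun_def h_def
    by (simp add: algebra_simps matrix_vector_right_distrib matrix_vector_mult_scaleR
        matrix_vector_mult_diff_distrib inner_simps)
  moreover have "\<theta> \<le> h y" if "\<forall>k. 0 \<le> sub_slack P k (x, y)" for y
    using gval_le[of P x y q] that g unfolding slack[symmetric] h_def by simp
  ultimately obtain y where y: "\<forall>k. 0 \<le> sub_slack P k (x, y)"
    and opt: "\<And>y'. \<forall>k. 0 \<le> sub_slack P k (x, y') \<Longrightarrow> h y \<le> h y'"
    using affine_fun_attains_minimum[of "\<lambda>k y. sub_slack P k (x, y)" h y0 \<theta>] y0 slack by blast
  have yf: "sub_feasible P (x, y)" using y slack by blast
  have "ereal (h y) \<le> gval P x q"
    unfolding gval_def
  proof (rule INF_greatest)
    fix y' assume "y' \<in> {y \<in> Y_set P. TO P *v x + WO P *v y \<le> hO P}"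
    then have "sub_feasible P (x, y')" unfolding sub_feasible_def by simp
    then show "ereal (h y) \<le> ereal (q \<bullet> (Qm P *v y'))"
      using opt slack unfolding h_def by simp
  qed
  then have "h y = \<theta>" using gval_le[OF yf, of q] g unfolding h_def by simp
  then show ?thesis using yf unfolding h_def by blast
qed

text \<open>
  The function \<open>f\<close>, objective minus cut, is affine and nonnegative on the joint feasible set, and it
  vanishes at the optimal \<open>(at_x s, y1)\<close>. If it were positive at \<open>(x2, y2)\<close> on the same face, a
  short step in the opposite direction would make it negative. Combined with the validity of the cut,
  this shows that the cut made at \<open>at_x s\<close> is exact at \<open>x2\<close>, whichever subgradient was returned.
\<close>

lemma exact_cut_tight_on_face:
  assumes s: "exact_solution P s"
    and z1: "sub_feasible P (at_x s, y1)" "at_q s \<bullet> (Qm P *v y1) = etheta s"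
    and z2: "sub_feasible P (x2, y2)"
    and face: "{k. sub_slack P k (at_x s, y1) = 0} = {k. sub_slack P k (x2, y2) = 0}"
  shows "at_q s \<bullet> (Qm P *v y2) \<le> etheta s + elam s \<bullet> (x2 - at_x s)"
proof -
  note slack = sub_feasible_slack[OF z1(1)]
  define f where "f z = at_q s \<bullet> (Qm P *v snd z) - etheta s - elam s \<bullet> (fst z - at_x s)" for z
  have f_nonneg: "0 \<le> f z" if "sub_feasible P z" for z
  proof -
    have "ereal (etheta s + elam s \<bullet> (fst z - at_x s)) \<le> gval P (fst z) (at_q s)"
      using s unfolding exact_solution_def by blast
    also have "\<dots> \<le> ereal (at_q s \<bullet> (Qm P *v snd z))"
      by (rule gval_le) (simp add: that)
    finally show ?thesis unfolding f_def by simp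
  qed
  have "affine_fun f"
    unfolding affine_fun_def f_def
    by (simp add: algebra_simps matrix_vector_right_distrib matrix_vector_mult_scaleR
        matrix_vector_mult_diff_distrib inner_simps)
  obtain t where t: "t > 0"
    "\<forall>k. 0 \<le> sub_slack P k (at_x s, y1) - t * (sub_slack P k (x2, y2) - sub_slack P k (at_x s, y1))"
  proof -
    have "sub_slack P k (at_x s, y1) = 0 \<longleftrightarrow> sub_slack P k (x2, y2) = 0" for k
      using face by blast
    moreover have "0 \<le> sub_slack P k (at_x s, y1)" "0 \<le> sub_slack P k (x2, y2)" for k
      using z1(1) z2 slack by blast+
    ultimately show thesis
      using that step_away_within_face[of UNIV "\<lambda>k. sub_slack P k (at_x s, y1)"
          "\<lambda>k. sub_slack P k (x2, y2)"] by (metis UNIV_I finite)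
  qed
  define z where "z = (at_x s, y1) + (- t) *\<^sub>R ((x2, y2) - (at_x s, y1))"
  have "sub_feasible P z"
    unfolding slack z_def affine_funD[OF affine_sub_slack] using t(2) by simp
  then have "0 \<le> f z" by (rule f_nonneg)
  also have "f z = - t * f (x2, y2)"
    unfolding z_def affine_funD[OF \<open>affine_fun f\<close>] using z1(2) by (simp add: f_def)
  finally have "f (x2, y2) \<le> 0" using t(1) by (simp add: mult_le_0_iff)
  then show ?thesis unfolding f_def by simp
qed


section \<open>The oracles\<close>

definition lower_value :: "('o::finite, 'q::finite) entry set \<Rightarrow> real^'o \<Rightarrow> (('o, 'q) entry \<Rightarrow> real) \<Rightarrow> real"
  where "lower_value S x \<mu> = (\<Sum>s\<in>S. \<mu> s * (etheta s + elam s \<bullet> (x - at_x s)))"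

definition lower_feasible :: "('o::finite, 'q::finite) entry set \<Rightarrow> real^'q \<Rightarrow> (('o, 'q) entry \<Rightarrow> real) \<Rightarrow> bool"
  where "lower_feasible S q \<mu> \<longleftrightarrow> simplex_weights S \<mu> \<and> (\<Sum>s\<in>S. \<mu> s *\<^sub>R at_q s) \<le> q"

text \<open>
  The returned cut is the affine function of \<open>x'\<close> obtained by freezing the optimal weights.
\<close>

lemma lower_oracleE:
  assumes "lower_oracle S x q \<theta> l"
  obtains \<mu> where "lower_feasible S q \<mu>"
    "\<And>\<nu>. lower_feasible S q \<nu> \<Longrightarrow> lower_value S x \<nu> \<le> \<theta>"
    "\<And>x'. \<theta> + l \<bullet> (x' - x) = lower_value S x' \<mu>"
proof -
  obtain \<mu> where \<mu>: "is_arg_max (lower_value S x) (lower_feasible S q) \<mu>"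
    "\<theta> = lower_value S x \<mu>" "l = (\<Sum>s\<in>S. \<mu> s *\<^sub>R elam s)"
    using assms unfolding lower_oracle_def lower_value_def[abs_def] lower_feasible_def[abs_def] by blast
  have "\<theta> + l \<bullet> (x' - x) = lower_value S x' \<mu>" for x'
    unfolding \<mu>(2,3) lower_value_def inner_sum_left sum.distrib[symmetric]
    by (intro sum.cong) (auto simp: algebra_simps inner_simps)
  with \<mu> show thesis
    by (intro that[of \<mu>]) (auto simp: is_arg_max_linorder)
qed

text \<open>
  Putting all the weight on one entry is feasible, so the lower oracle is at least as good as
  each single Benders cut whose \<open>q\<close> lies below the present one.
\<close>

lemma lower_oracle_ge_entry:
  assumes "lower_oracle S x q \<theta> l" "finite S" "s \<in> S" "at_q s \<le> q"
  shows "etheta s + elam s \<bullet> (x - at_x s) \<le> \<theta>"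
proof -
  define \<delta> :: "('a, 'b) entry \<Rightarrow> real" where "\<delta> s' = (if s' = s then 1 else 0)" for s'
  have "(\<Sum>s'\<in>S. \<delta> s' *\<^sub>R at_q s') = (\<Sum>s'\<in>S. if s' = s then at_q s else 0)"
    unfolding \<delta>_def by (intro sum.cong) auto
  then have "lower_feasible S q \<delta>"
    using assms(2-4) unfolding lower_feasible_def simplex_weights_def by (simp add: \<delta>_def)
  with assms(1) have "lower_value S x \<delta> \<le> \<theta>" by (blast elim: lower_oracleE)
  moreover have "lower_value S x \<delta> = (\<Sum>s'\<in>S. if s' = s then etheta s + elam s \<bullet> (x - at_x s) else 0)"
    unfolding lower_value_def \<delta>_def by (intro sum.cong) auto
  ultimately show ?thesis using assms(2,3) by simp
qed

text \<open>
  Two weight vectors have the same face of the weight polytope if they have the same zeros and the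
  same tight rows of \<open>\<Sum>s\<in>S. \<mu> s *\<^sub>R at_q s \<le> q\<close>. A linear function maximal at \<open>\<mu>'\<close> is
  constant on the face of \<open>\<mu>'\<close>, so \<open>\<mu>\<close> is maximal as well. In the algorithm, \<open>\<mu>\<close> belongs to an older
  iteration, and the conclusion says that the cut made there is tight at \<open>x\<close>.
\<close>

lemma oracle_weights_optimal_on_face:
  assumes fin: "finite S"
    and \<mu>: "lower_feasible S q \<mu>"
    and \<mu>': "lower_feasible S q \<mu>'"
    and opt: "\<And>\<nu>. lower_feasible S q \<nu> \<Longrightarrow> lower_value S x \<nu> \<le> lower_value S x \<mu>'"
    and face: "{s \<in> S. \<mu> s = 0} = {s \<in> S. \<mu>' s = 0}"
      "{k. (\<Sum>s\<in>S. \<mu> s *\<^sub>R at_q s) $ k = q $ k} = {k. (\<Sum>s\<in>S. \<mu>' s *\<^sub>R at_q s) $ k = q $ k}"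
  shows "lower_value S x \<mu>' \<le> lower_value S x \<mu>"
proof -
  define C where "C \<mu> = (\<Sum>s\<in>S. \<mu> s *\<^sub>R at_q s)" for \<mu>
  have Cle: "C \<mu> $ k \<le> q $ k" "C \<mu>' $ k \<le> q $ k" for k
    using \<mu> \<mu>' unfolding lower_feasible_def C_def less_eq_vec_def by auto
  have w: "0 \<le> \<mu> s" "0 \<le> \<mu>' s" if "s \<in> S" for s
    using \<mu> \<mu>' that unfolding lower_feasible_def simplex_weights_def by auto
  have zeros: "\<mu>' s = 0 \<longleftrightarrow> \<mu> s = 0" if "s \<in> S" for s using face(1) that by blast
  have tight: "C \<mu>' $ k = q $ k \<longleftrightarrow> C \<mu> $ k = q $ k" for k using face(2) unfolding C_def by blast
  define slack where "slack \<mu> c = (case c of Inl s \<Rightarrow> \<mu> s | Inr k \<Rightarrow> q $ k - C \<mu> $ k)" for \<mu> c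
  have "\<exists>t>0. \<forall>c \<in> S <+> UNIV. 0 \<le> slack \<mu>' c - t * (slack \<mu> c - slack \<mu>' c)"
    using fin w Cle zeros tight by (intro step_away_within_face) (auto simp: slack_def eq_commute[of "q $ _"])
  then obtain t where t: "t > 0" "\<And>c. c \<in> S <+> UNIV \<Longrightarrow> 0 \<le> slack \<mu>' c - t * (slack \<mu> c - slack \<mu>' c)"
    by blast
  define \<nu> where "\<nu> s = \<mu>' s - t * (\<mu> s - \<mu>' s)" for s
  have C\<nu>: "C \<nu> = C \<mu>' - t *\<^sub>R (C \<mu> - C \<mu>')"
    unfolding C_def \<nu>_def
    by (simp add: scaleR_diff_left sum_subtractf scaleR_sum_right scaleR_diff_right
        right_diff_distrib)
  have "lower_feasible S q \<nu>"
    unfolding lower_feasible_def simplex_weights_def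
  proof (intro conjI ballI)
    fix s assume "s \<in> S"
    then show "0 \<le> \<nu> s" using t(2)[of "Inl s"] by (auto simp: slack_def \<nu>_def)
  next
    have "(\<Sum>s\<in>S. \<nu> s) = (\<Sum>s\<in>S. \<mu>' s) - t * ((\<Sum>s\<in>S. \<mu> s) - (\<Sum>s\<in>S. \<mu>' s))"
      unfolding \<nu>_def by (simp add: sum_subtractf sum_distrib_left right_diff_distrib)
    then show "(\<Sum>s\<in>S. \<nu> s) = 1"
      using \<mu> \<mu>' unfolding lower_feasible_def simplex_weights_def by simp
  next
    have "C \<nu> $ k \<le> q $ k" for k
      using t(2)[of "Inr k"] unfolding C\<nu> by (auto simp: slack_def algebra_simps)
    then show "(\<Sum>s\<in>S. \<nu> s *\<^sub>R at_q s) \<le> q" unfolding C_def less_eq_vec_def by blast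
  qed
  then have "lower_value S x \<nu> \<le> lower_value S x \<mu>'" by (rule opt)
  also have "lower_value S x \<nu> = lower_value S x \<mu>' - t * (lower_value S x \<mu> - lower_value S x \<mu>')"
    unfolding lower_value_def \<nu>_def
    by (simp add: sum_subtractf sum_distrib_left left_diff_distrib right_diff_distrib mult.assoc)
  finally show ?thesis using t(1) by (simp add: zero_le_mult_iff)
qed

text \<open>
  The hypograph of \<open>g(x', \<cdot>)\<close> is convex and contains the values of the single cuts at \<open>x'\<close>, hence also
  their average; monotonicity in \<open>q\<close> passes from the averaged \<open>q\<close> to the present one. Working
  in the hypograph covers those \<open>x'\<close> at which the subproblem is infeasible.
\<close>

lemma lower_oracle_cut_valid:
  assumes stand: "standing_condition P"
    and fin: "finite S" and ex: "\<And>s. s \<in> S \<Longrightarrow> exact_solution P s"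
    and low: "lower_oracle S x q \<theta> l"
  shows "ereal (\<theta> + l \<bullet> (x' - x)) \<le> gval P x' q"
proof -
  obtain \<mu> where \<mu>: "lower_feasible S q \<mu>" "\<And>x'. \<theta> + l \<bullet> (x' - x) = lower_value S x' \<mu>"
    using low by (rule lower_oracleE) blast
  define C where "C = {(q, r::real). ereal r \<le> gval P x' q}"
  have "convex C" using stand unfolding standing_condition_def C_def by blast
  moreover have "(at_q s, etheta s + elam s \<bullet> (x' - at_x s)) \<in> C" if "s \<in> S" for s
    using ex[OF that] unfolding exact_solution_def C_def by simp
  ultimately have "(\<Sum>s\<in>S. \<mu> s *\<^sub>R (at_q s, etheta s + elam s \<bullet> (x' - at_x s))) \<in> C"
    using \<mu>(1) fin unfolding lower_feasible_def simplex_weights_def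
    by (intro convex_sum) auto
  then have "ereal (lower_value S x' \<mu>) \<le> gval P x' (\<Sum>s\<in>S. \<mu> s *\<^sub>R at_q s)"
    unfolding C_def lower_value_def by (auto simp: sum_prod)
  also have "\<dots> \<le> gval P x' q"
    using stand \<mu>(1) unfolding standing_condition_def lower_feasible_def by (meson monoD)
  finally show ?thesis unfolding \<mu>(2) .
qed

text \<open>
  The mirror image of the previous argument, with the epigraph of \<open>g(\<cdot>, q)\<close> in place of the hypograph.
\<close>

lemma upper_oracle_valid:
  assumes stand: "standing_condition P"
    and fin: "finite S" and ex: "\<And>s. s \<in> S \<Longrightarrow> exact_solution P s"
    and up: "upper_oracle S x q \<theta>"
  shows "gval P x q \<le> ereal \<theta>"
proof -
  obtain \<mu> where \<mu>: "simplex_weights S \<mu>" "(\<Sum>s\<in>S. \<mu> s *\<^sub>R at_x s) \<le> x"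
    "\<theta> = (\<Sum>s\<in>S. \<mu> s * (etheta s + ephi s \<bullet> (q - at_q s)))"
    using up unfolding upper_oracle_def is_arg_min_def by blast
  define C where "C = {(x, r::real). gval P x q \<le> ereal r}"
  have "convex C" using stand unfolding standing_condition_def C_def by blast
  moreover have "(at_x s, etheta s + ephi s \<bullet> (q - at_q s)) \<in> C" if "s \<in> S" for s
    using ex[OF that] unfolding exact_solution_def C_def by simp
  ultimately have "(\<Sum>s\<in>S. \<mu> s *\<^sub>R (at_x s, etheta s + ephi s \<bullet> (q - at_q s))) \<in> C"
    using \<mu>(1) fin unfolding simplex_weights_def by (intro convex_sum) auto
  then have "gval P (\<Sum>s\<in>S. \<mu> s *\<^sub>R at_x s) q \<le> ereal \<theta>"
    unfolding C_def \<mu>(3) by (auto simp: sum_prod)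
  moreover have "gval P x q \<le> gval P (\<Sum>s\<in>S. \<mu> s *\<^sub>R at_x s) q"
    using stand \<mu>(2) unfolding standing_condition_def by (blast dest: monotoneD)
  ultimately show ?thesis by (rule order_trans[rotated])
qed

lemma upper_oracle_unique:
  assumes "upper_oracle S x q \<theta>" "upper_oracle S x q \<theta>'"
  shows "\<theta> = \<theta>'"
  using assms unfolding upper_oracle_def is_arg_min_linorder by (force intro: antisym)


section \<open>Validity of the bounds\<close>

lemma value_with_mono:
  assumes "well_formed P" "\<And>i. prob P i * b i \<le> prob P i * b' i"
  shows "value_with P x b \<le> value_with P x b'"
  unfolding value_with_def using assms(2) by (intro sum_mono) (simp add: distrib_left)

lemma prob_nonneg: "well_formed P \<Longrightarrow> 0 \<le> prob P i"
  unfolding well_formed_def scenario_tree_def by blast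

locale benders_execution =
  fixes P :: "('i::finite, 'v::finite, 'r::finite, 'o::finite, 'q::finite, 'y::finite, 'm::finite) mhsp"
    and A :: "('o, 'q) parameters"
    and R :: "('i, 'v, 'o, 'q) run"
  assumes wf: "well_formed P"
    and stand: "standing_condition P"
    and params: "valid_parameters P A"
    and exec: "execution P A R"
begin

lemma iteration: "reached A R j \<Longrightarrow> iteration P A R j"
  using exec unfolding execution_def by blast

lemma reached_earlier: "reached A R j \<Longrightarrow> 1 \<le> k \<Longrightarrow> k \<le> j \<Longrightarrow> reached A R k"
  unfolding reached_def by simp

lemma inner_pass: "reached A R j \<Longrightarrow> p < passes R j \<Longrightarrow> inner_pass P R j p"
  using iteration[of j] unfolding iteration_def inner_loop_def by blast

lemma oracles_called:
  assumes "reached A R j" "p \<le> passes R j"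
  shows "oracles_called P R j p"
  using assms iteration[of j] inner_pass[of j "p - 1"]
  by (cases p) (auto simp: iteration_def inner_pass_def)

lemma Sset_carried_over:
  "reached A R j \<Longrightarrow> Sset R j 0 = Sset R (j - 1) (passes R (j - 1))"
  using iteration[of j] unfolding iteration_def by blast

lemma Sset_pass:
  assumes "reached A R j" "p < passes R j"
  shows "Sset R j (Suc p) = (if low R j p (ihat R j p) < etheta (sol R j p)
           then insert (sol R j p) (Sset R j p) else Sset R j p)"
  using inner_pass[OF assms] unfolding inner_pass_def by (simp split: if_splits)

lemma entries_exact:
  assumes "j = 0 \<or> reached A R j" "p \<le> passes R j"
  shows "finite (Sset R j p) \<and> (\<forall>s\<in>Sset R j p. exact_solution P s)"
  using assms
proof (induction j arbitrary: p)
  case 0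
  have init: "initialised P A R" using exec unfolding execution_def by blast
  then have "p = 0" using 0 unfolding initialised_def by simp
  then show ?case using init unfolding initialised_def by auto
next
  case (Suc j)
  then have reached: "reached A R (Suc j)" by simp
  then have "j = 0 \<or> reached A R j" using reached_earlier[of "Suc j" j] by (cases j) auto
  then have start: "finite (Sset R (Suc j) 0) \<and> (\<forall>s\<in>Sset R (Suc j) 0. exact_solution P s)"
    using Suc.IH[of "passes R j"] Sset_carried_over[OF reached] by simp
  show ?case using Suc.prems(2)
  proof (induction p)
    case 0
    show ?case by (rule start)
  next
    case (Suc p)
    then show ?case
      using Sset_pass[OF reached, of p] inner_pass[OF reached, of p] by (auto simp: inner_pass_def)
  qed
qed

lemma Sset_mono_passes:
  assumes "reached A R j" "p \<le> p'" "p' \<le> passes R j"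
  shows "Sset R j p \<subseteq> Sset R j p'"
  using assms(2,3)
proof (induction p' rule: dec_induct)
  case (step n)
  then show ?case using Sset_pass[OF assms(1), of n] by auto
qed simp

lemma Sset_mono_iterations:
  assumes "reached A R j'" "j < j'"
  shows "Sset R j (passes R j) \<subseteq> Sset R j' 0"
  using assms(2,1)
proof (induction j')
  case (Suc n)
  show ?case
  proof (cases "j = n")
    case True
    then show ?thesis using Sset_carried_over[OF Suc.prems(2)] by simp
  next
    case False
    then have n: "j < n" "reached A R n"
      using Suc.prems reached_earlier[of "Suc n" n] by auto
    then have "Sset R j (passes R j) \<subseteq> Sset R n 0" by (rule Suc.IH)
    also have "\<dots> \<subseteq> Sset R n (passes R n)" using n by (intro Sset_mono_passes) auto
    finally show ?thesis using Sset_carried_over[OF Suc.prems(2)] by simp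
  qed
qed simp

text \<open>
  The flag \<open>\<xi>\<close> records whether some pass so far has found a value above the lower oracle; as long as
  it has not been set, the collection is the one with which the iteration began.
\<close>

lemma xi_records_improvement:
  assumes "reached A R j" "p \<le> passes R j"
  shows "if xi R j p then \<exists>p'<p. low R j p' (ihat R j p') < etheta (sol R j p')
         else Sset R j p = Sset R j 0"
  using assms(2)
proof (induction p)
  case 0
  then show ?case using iteration[OF assms(1)] unfolding iteration_def by simp
next
  case (Suc p)
  then show ?case
    using inner_pass[OF assms(1), of p] unfolding inner_pass_def
    by (auto simp: less_Suc_eq split: if_splits)
qed

lemma cut_valid:
  assumes "reached A R j"
  shows "ereal (low R j (passes R j) i + lam R j (passes R j) i \<bullet> (x - xO P (xhat R j) i))
    \<le> gval P x (qvec P i)"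
  using lower_oracle_cut_valid[OF stand] entries_exact[of j "passes R j"]
    oracles_called[OF assms, of "passes R j"] assms unfolding oracles_called_def by blast

text \<open>
  The reduced master problem is a relaxation: at a feasible \<open>x\<close>, the subproblem values satisfy all cuts
  and can be taken as \<open>\<beta>\<close>. If the subproblem of a node is infeasible at \<open>x\<close>, its value \<open>\<infinity>\<close> is not
  a possible \<open>\<beta>\<close>, and the largest of the finitely many lower bounds on \<open>\<beta>\<close> is used instead; this also
  serves for nodes of probability \<open>0\<close>, where the infinite value is multiplied away.
\<close>

lemma Lstar_le_optimal_value:
  assumes j: "reached A R j"
  shows "ereal (Lstar R j) \<le> optimal_value P"
  unfolding optimal_value_def
proof (rule INF_greatest)
  fix x assume x: "x \<in> feasible P"
  define cut where
    "cut k i = low R k (passes R k) i + lam R k (passes R k) i \<bullet> (xO P x i - xO P (xhat R k) i)" for k i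
  have "\<exists>b. beta_low A \<le> b \<and> (\<forall>k\<in>{1..<j}. cut k i \<le> b) \<and>
      ereal (prob P i * (cost P i \<bullet> xpart P x i + b))
        \<le> ereal (prob P i) * (ereal (cost P i \<bullet> xpart P x i) + gval P (xO P x i) (qvec P i))" for i
  proof -
    have low: "ereal (beta_low A) \<le> gval P (xO P x i) (qvec P i)"
      using params x unfolding valid_parameters_def by blast
    have cuts: "ereal (cut k i) \<le> gval P (xO P x i) (qvec P i)" if "k \<in> {1..<j}" for k
      unfolding cut_def using that by (intro cut_valid reached_earlier[OF j]) auto
    show ?thesis
    proof (cases "gval P (xO P x i) (qvec P i)")
      case (real g)
      then show ?thesis using low cuts by (intro exI[of _ g]) auto
    next
      case PInf
      define B where "B = insert (beta_low A) ((\<lambda>k. cut k i) ` {1..<j})"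
      have "b \<le> Max B" if "b \<in> B" for b using that unfolding B_def by (intro Max_ge) auto
      then have "beta_low A \<le> Max B" "\<forall>k\<in>{1..<j}. cut k i \<le> Max B"
        unfolding B_def by blast+
      moreover have "ereal (prob P i * (cost P i \<bullet> xpart P x i + Max B))
          \<le> ereal (prob P i) * (ereal (cost P i \<bullet> xpart P x i) + gval P (xO P x i) (qvec P i))"
        using prob_nonneg[OF wf, of i] unfolding PInf by (cases "prob P i = 0") auto
      ultimately show ?thesis by blast
    next
      case MInf
      then show ?thesis using low by simp
    qed
  qed
  then obtain b where b: "\<And>i. beta_low A \<le> b i" "\<And>i k. k\<in>{1..<j} \<Longrightarrow> cut k i \<le> b i"
      "\<And>i. ereal (prob P i * (cost P i \<bullet> xpart P x i + b i))
        \<le> ereal (prob P i) * (ereal (cost P i \<bullet> xpart P x i) + gval P (xO P x i) (qvec P i))"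
    by metis
  have "cuts_hold P A R j x b" using b(1,2) unfolding cuts_hold_def cut_def by blast
  then have "Lstar R j \<le> value_with P x b"
    using iteration[OF j] x unfolding iteration_def RMP_solution_def is_arg_min_linorder by auto
  moreover have "ereal (value_with P x b) \<le> objective P x"
    unfolding value_with_def objective_def sum_ereal[symmetric] using b(3) by (intro sum_mono) auto
  ultimately show "ereal (Lstar R j) \<le> objective P x"
    by (meson ereal_less_eq(3) order_trans)
qed

lemma objective_le_Ubd:
  assumes k: "reached A R k"
  shows "objective P (xRMP R k) \<le> ereal (Ubd R k)"
proof -
  have up: "gval P (xO P (xRMP R k) i) (qvec P i) \<le> ereal (upRMP R k i)" for i
    using iteration[OF k] entries_exact[of k "passes R k"] k unfolding iteration_def
    by (blast intro: upper_oracle_valid[OF stand])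
  have "objective P (xRMP R k)
      \<le> (\<Sum>i\<in>UNIV. ereal (prob P i * (cost P i \<bullet> xpart P (xRMP R k) i + upRMP R k i)))"
    unfolding objective_def
  proof (rule sum_mono)
    fix i
    have "ereal (prob P i) * (ereal (cost P i \<bullet> xpart P (xRMP R k) i) + gval P (xO P (xRMP R k) i) (qvec P i))
      \<le> ereal (prob P i) * (ereal (cost P i \<bullet> xpart P (xRMP R k) i) + ereal (upRMP R k i))"
      using up prob_nonneg[OF wf] by (intro ereal_mult_left_mono add_left_mono) auto
    then show "ereal (prob P i) * (ereal (cost P i \<bullet> xpart P (xRMP R k) i) + gval P (xO P (xRMP R k) i) (qvec P i))
      \<le> ereal (prob P i * (cost P i \<bullet> xpart P (xRMP R k) i + upRMP R k i))" by simp
  qed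
  also have "\<dots> = ereal (Ubd R k)"
    using iteration[OF k] unfolding iteration_def value_with_def by simp
  finally show ?thesis .
qed

lemma Ustar_attained:
  assumes "reached A R j"
  shows "\<exists>k\<in>{1..j}. ereal (Ubd R k) = Ustar R j"
  using assms
proof (induction j)
  case 0
  then show ?case unfolding reached_def by simp
next
  case (Suc j)
  have step: "Ustar R (Suc j) = min (Ustar R j) (ereal (Ubd R (Suc j)))"
    using iteration[OF Suc.prems] unfolding iteration_def by simp
  show ?case
  proof (cases "j = 0")
    case True
    have "Ustar R 0 = \<infinity>" using exec unfolding execution_def initialised_def by blast
    then show ?thesis using step True by (simp add: min_def)
  next
    case False
    then obtain k where "k \<in> {1..j}" "ereal (Ubd R k) = Ustar R j"
      using Suc.IH reached_earlier[OF Suc.prems, of j] by auto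
    then show ?thesis
      unfolding step min_def by (cases "Ustar R j \<le> ereal (Ubd R (Suc j))") force+
  qed
qed

lemma stops_if_Ustar_le_Lstar:
  assumes j: "reached A R j" and le: "Ustar R j \<le> ereal (Lstar R j)"
  shows "stops A R j"
proof -
  obtain u where "Ustar R j = ereal u" using Ustar_attained[OF j] by metis
  moreover have "0 \<le> tol A" using params unfolding valid_parameters_def by blast
  ultimately show ?thesis using le unfolding stops_def by simp
qed

lemma stops_eps_optimal:
  assumes J: "reached A R J" "stops A R J"
    and k: "k \<in> {1..J}" "ereal (Ubd R k) = Ustar R J"
  shows "eps_optimal P (tol A) (xRMP R k)"
proof -
  have rk: "reached A R k" using reached_earlier[OF J(1)] k(1) by simp
  have "xRMP R k \<in> feasible P"
    using iteration[OF rk] unfolding iteration_def RMP_solution_def is_arg_min_def by simp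
  moreover have "objective P (xRMP R k) \<le> optimal_value P + ereal (tol A)"
  proof -
    have "objective P (xRMP R k) \<le> ereal (Ubd R k)" by (rule objective_le_Ubd[OF rk])
    also have "\<dots> \<le> ereal (Lstar R J) + ereal (tol A)"
      using J(2) unfolding stops_def k(2)[symmetric] by simp
    also have "\<dots> \<le> optimal_value P + ereal (tol A)"
      using Lstar_le_optimal_value[OF J(1)] by (rule add_right_mono)
    finally show ?thesis .
  qed
  ultimately show ?thesis unfolding eps_optimal_def by blast
qed


section \<open>Finiteness\<close>

text \<open>
  Attach to each such iteration the node of an improving pass and the face that contains
  the optimal \<open>(x, y)\<close> found there. If two iterations had the same node and face, the entry stored in
  the first would already be exact at the point of the second, and the second pass would not improve
  on the lower oracle.
\<close>

lemma finitely_many_improving_iterations: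
  assumes never: "\<And>j. 1 \<le> j \<Longrightarrow> reached A R j"
  shows "finite {j. 1 \<le> j \<and> xi R j (passes R j)}"
proof (rule ccontr)
  define N where "N = {j. 1 \<le> j \<and> xi R j (passes R j)}"
  assume "infinite {j. 1 \<le> j \<and> xi R j (passes R j)}"
  then have inf: "infinite N" unfolding N_def .
  have "\<exists>p<passes R j. low R j p (ihat R j p) < etheta (sol R j p)" if "j \<in> N" for j
    using xi_records_improvement[OF never, of j "passes R j"] that unfolding N_def by auto
  then obtain p where p: "\<And>j. j \<in> N \<Longrightarrow> p j < passes R j"
    "\<And>j. j \<in> N \<Longrightarrow> low R j (p j) (ihat R j (p j)) < etheta (sol R j (p j))"
    by metis
  define i where "i j = ihat R j (p j)" for j
  define s where "s j = sol R j (p j)" for j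
  have s: "exact_solution P (s j)" "at_x (s j) = xO P (xhat R j) (i j)" "at_q (s j) = qvec P (i j)"
    "s j \<in> Sset R j (Suc (p j))" if "j \<in> N" for j
    using inner_pass[OF never p(1)[OF that]] p(2)[OF that] that
    unfolding inner_pass_def s_def i_def N_def by auto
  have "\<exists>y. sub_feasible P (at_x (s j), y) \<and> at_q (s j) \<bullet> (Qm P *v y) = etheta (s j)" if "j \<in> N" for j
    using s(1)[OF that] unfolding exact_solution_def by (blast intro: gval_attained)
  then obtain y where y: "\<And>j. j \<in> N \<Longrightarrow> sub_feasible P (at_x (s j), y j)"
    "\<And>j. j \<in> N \<Longrightarrow> at_q (s j) \<bullet> (Qm P *v y j) = etheta (s j)"
    by metis
  define face where "face j = (i j, {k. sub_slack P k (at_x (s j), y j) = 0})" for j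
  obtain j where j: "j \<in> N" "infinite {j' \<in> N. face j' = face j}"
    using pigeonhole_infinite[OF inf, of face] by auto
  then obtain j' where j': "j' \<in> N" "face j' = face j" "j < j'"
    by (metis (mono_tags, lifting) infinite_nat_iff_unbounded mem_Collect_eq)
  have r: "reached A R j" "reached A R j'" using never j(1) j'(1) unfolding N_def by auto
  have "s j \<in> Sset R j' (p j')"
  proof -
    have "Sset R j (Suc (p j)) \<subseteq> Sset R j (passes R j)"
      using p(1)[OF j(1)] by (intro Sset_mono_passes[OF r(1)]) auto
    also have "\<dots> \<subseteq> Sset R j' 0" by (rule Sset_mono_iterations[OF r(2) j'(3)])
    also have "\<dots> \<subseteq> Sset R j' (p j')"
      using p(1)[OF j'(1)] by (intro Sset_mono_passes[OF r(2)]) auto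
    finally show ?thesis using s(4)[OF j(1)] by blast
  qed
  moreover have "lower_oracle (Sset R j' (p j')) (at_x (s j')) (qvec P (i j'))
      (low R j' (p j') (i j')) (lam R j' (p j') (i j'))"
    using oracles_called[OF r(2), of "p j'"] p(1)[OF j'(1)] s(2)[OF j'(1)]
    unfolding oracles_called_def by simp
  moreover have "finite (Sset R j' (p j'))"
    using entries_exact[of j' "p j'"] r(2) p(1)[OF j'(1)] by simp
  moreover have same_q: "at_q (s j) = at_q (s j')" "at_q (s j) = qvec P (i j')"
    using s(3) j(1) j'(1,2) unfolding face_def by auto
  ultimately have "etheta (s j) + elam (s j) \<bullet> (at_x (s j') - at_x (s j)) \<le> low R j' (p j') (i j')"
    by (intro lower_oracle_ge_entry) auto
  moreover have "at_q (s j) \<bullet> (Qm P *v y j')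
      \<le> etheta (s j) + elam (s j) \<bullet> (at_x (s j') - at_x (s j))"
    using s(1)[OF j(1)] y j(1) j'(1,2) unfolding face_def
    by (intro exact_cut_tight_on_face[of P "s j" "y j"]) auto
  ultimately have "etheta (s j') \<le> low R j' (p j') (i j')"
    using y(2)[OF j'(1)] same_q by simp
  then show False using p(2)[OF j'(1)] unfolding s_def i_def by simp
qed

text \<open>
  With \<open>\<xi> = 0\<close>, the inner loop ends in one of two ways. If the oracles agree at every node of
  positive probability, then \<open>Lhat = Uhat\<close>, and \<open>Uhat = Ubd\<close> since \<open>xhat\<close> is the point of the reduced master
  problem. Otherwise \<open>Lhat\<close> has reached the previous incumbent value. Either way \<open>Ustar \<le> Lhat\<close>.
\<close>

lemma stops_if_Lhat_le_Lstar:
  assumes j: "reached A R j"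
    and x: "xhat R j = xRMP R j"
    and xi: "\<not> xi R j (passes R j)"
    and le: "Lhat P R j (passes R j) \<le> Lstar R j"
  shows "stops A R j"
proof -
  note it = iteration[OF j, unfolded iteration_def]
  have Ustar: "Ustar R j = min (Ustar R (j - 1)) (ereal (Ubd R j))" using it by blast
  have "no_gap P R j (passes R j) \<or> Ustar R (j - 1) \<le> ereal (Lhat P R j (passes R j))"
    using it xi unfolding inner_loop_def until_condition_def by blast
  then have "Ustar R j \<le> ereal (Lhat P R j (passes R j))"
  proof
    assume gap: "no_gap P R j (passes R j)"
    have "upRMP R j i = up R j (passes R j) i" for i
      using it oracles_called[OF j, of "passes R j"] x unfolding oracles_called_def
      by (metis order_refl upper_oracle_unique)
    moreover have "prob P i * up R j (passes R j) i \<le> prob P i * low R j (passes R j) i" for i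
    proof -
      have "gap P R j (passes R j) i \<le> 0"
        using gap Max_ge[of "range (gap P R j (passes R j))" "gap P R j (passes R j) i"]
        unfolding no_gap_def by simp
      then show ?thesis unfolding gap_def by (simp add: right_diff_distrib)
    qed
    ultimately have "value_with P (xRMP R j) (upRMP R j) \<le> Lhat P R j (passes R j)"
      unfolding Lhat_def x by (intro value_with_mono[OF wf]) simp
    then have "Ubd R j \<le> Lhat P R j (passes R j)" using it by simp
    then show ?thesis unfolding Ustar by (simp add: min.coboundedI2)
  next
    assume "Ustar R (j - 1) \<le> ereal (Lhat P R j (passes R j))"
    then show ?thesis unfolding Ustar by (rule min.coboundedI1)
  qed
  also have "\<dots> \<le> ereal (Lstar R j)" using le by simp
  finally show ?thesis by (rule stops_if_Ustar_le_Lstar[OF j])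
qed

lemma Lhat_le_Lstar_if_cuts_tight:
  assumes j: "reached A R j" and k: "1 \<le> k" "k < j"
    and x: "xhat R j = xRMP R j"
    and tight: "\<And>i. low R j (passes R j) i
      \<le> low R k (passes R k) i + lam R k (passes R k) i \<bullet> (xO P (xhat R j) i - xO P (xhat R k) i)"
  shows "Lhat P R j (passes R j) \<le> Lstar R j"
proof -
  note it = iteration[OF j, unfolded iteration_def]
  have "cuts_hold P A R j (xRMP R j) (beta R j)"
    using it unfolding RMP_solution_def is_arg_min_def by simp
  then have "low R j (passes R j) i \<le> beta R j i" for i
    using k tight[of i] unfolding cuts_hold_def x by (meson atLeastLessThan_iff order_trans)
  then have "value_with P (xRMP R j) (low R j (passes R j)) \<le> value_with P (xRMP R j) (beta R j)"
    using prob_nonneg[OF wf] by (intro value_with_mono[OF wf] mult_left_mono) auto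
  then show ?thesis using it unfolding Lhat_def x by simp
qed

text \<open>
  Past the last improving iteration the only remaining source of progress are the cuts of the reduced
  master problem, and these are exhausted once the faces of the oracle weights of all nodes recur
  simultaneously.
\<close>

lemma eventually_stops: "\<exists>J. reached A R J \<and> stops A R J"
proof (rule ccontr)
  assume no_stop: "\<nexists>J. reached A R J \<and> stops A R J"
  have never: "reached A R j" if "1 \<le> j" for j
    using that
  proof (induction j rule: less_induct)
    case (less j)
    then show ?case using no_stop unfolding reached_def[of A R j] by auto
  qed
  obtain J0 where J0: "\<And>j. 1 \<le> j \<Longrightarrow> xi R j (passes R j) \<Longrightarrow> j < J0"
    using finitely_many_improving_iterations[OF never] unfolding finite_nat_set_iff_bounded by blast
  \<comment> \<open>The flag of iteration \<open>j - 1\<close> decides whether \<open>j\<close> uses a centred point,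
    so both \<open>j\<close> and \<open>j - 1\<close> have to be past the last improving iteration.\<close>
  define J1 where "J1 = Suc (Suc J0)"
  have tail: "\<not> xi R j (passes R j)" "xhat R j = xRMP R j" "Sset R j (passes R j) = Sset R j 0"
    "reached A R j" if j: "J1 \<le> j" for j
  proof -
    show r: "reached A R j" using j never unfolding J1_def by simp
    show xi: "\<not> xi R j (passes R j)" using J0[of j] j unfolding J1_def by auto
    have "1 \<le> j - 1" "\<not> j - 1 < J0" using j unfolding J1_def by auto
    then have "\<not> CP_solved R j" using J0 unfolding CP_solved_def by blast
    then show "xhat R j = xRMP R j" using iteration[OF r] unfolding iteration_def by simp
    show "Sset R j (passes R j) = Sset R j 0" using xi_records_improvement[OF r, of "passes R j"] xi by simp
  qed
  define S where "S = Sset R J1 0"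
  have S: "Sset R j (passes R j) = S" if "J1 \<le> j" for j
    using that
  proof (induction j rule: dec_induct)
    case base
    then show ?case using tail(3)[of J1] unfolding S_def by simp
  next
    case (step j)
    then show ?case using tail(3,4)[of "Suc j"] Sset_carried_over[of "Suc j"] by simp
  qed
  have finS: "finite S" using S[of J1] entries_exact[of J1 "passes R J1"] tail(4)[of J1] by simp
  have "\<exists>\<mu>. lower_feasible S (qvec P i) \<mu> \<and>
      (\<forall>\<nu>. lower_feasible S (qvec P i) \<nu> \<longrightarrow>
         lower_value S (xO P (xhat R j) i) \<nu> \<le> low R j (passes R j) i) \<and>
      (\<forall>x'. low R j (passes R j) i + lam R j (passes R j) i \<bullet> (x' - xO P (xhat R j) i)
         = lower_value S x' \<mu>)"
    if j: "J1 \<le> j" for j i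
  proof -
    have "lower_oracle S (xO P (xhat R j) i) (qvec P i) (low R j (passes R j) i) (lam R j (passes R j) i)"
      using oracles_called[OF tail(4)[OF j], of "passes R j"] S[OF j] unfolding oracles_called_def by simp
    then show ?thesis by (rule lower_oracleE) blast
  qed
  then obtain \<mu> where \<mu>: "\<And>j i. J1 \<le> j \<Longrightarrow> lower_feasible S (qvec P i) (\<mu> j i)"
    "\<And>j i \<nu>. J1 \<le> j \<Longrightarrow> lower_feasible S (qvec P i) \<nu> \<Longrightarrow>
       lower_value S (xO P (xhat R j) i) \<nu> \<le> low R j (passes R j) i"
    "\<And>j i x'. J1 \<le> j \<Longrightarrow>
       low R j (passes R j) i + lam R j (passes R j) i \<bullet> (x' - xO P (xhat R j) i)
         = lower_value S x' (\<mu> j i)"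
    by metis
  have low: "low R j (passes R j) i = lower_value S (xO P (xhat R j) i) (\<mu> j i)" if "J1 \<le> j" for j i
    using \<mu>(3)[OF that, of i "xO P (xhat R j) i"] by simp
  define face where "face j = (\<lambda>i. ({s \<in> S. \<mu> j i s = 0},
    {k. (\<Sum>s\<in>S. \<mu> j i s *\<^sub>R at_q s) $ k = qvec P i $ k}))" for j
  have "face ` {J1..} \<subseteq> (UNIV \<rightarrow>\<^sub>E Pow S \<times> UNIV)" unfolding face_def by auto
  moreover have "finite ((UNIV :: 'i set) \<rightarrow>\<^sub>E Pow S \<times> (UNIV :: 'q set set))"
    using finS by (intro finite_PiE) auto
  ultimately have "finite (face ` {J1..})" by (rule finite_subset)
  then have "\<not> inj_on face {J1..}" using finite_imageD infinite_Ici by blast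
  then obtain k j where kj: "J1 \<le> k" "k < j" "face k = face j"
    unfolding inj_on_def by (metis atLeast_iff linorder_neqE_nat)
  have j: "J1 \<le> j" using kj by simp
  have "low R j (passes R j) i
      \<le> low R k (passes R k) i + lam R k (passes R k) i \<bullet> (xO P (xhat R j) i - xO P (xhat R k) i)" for i
    unfolding \<mu>(3)[OF kj(1)] low[OF j]
  proof (rule oracle_weights_optimal_on_face[OF finS \<mu>(1)[OF kj(1)] \<mu>(1)[OF j]])
    show "lower_value S (xO P (xhat R j) i) \<nu> \<le> lower_value S (xO P (xhat R j) i) (\<mu> j i)"
      if "lower_feasible S (qvec P i) \<nu>" for \<nu>
      using \<mu>(2)[OF j that] low[OF j, of i] by simp
  qed (use fun_cong[OF kj(3), of i] in \<open>simp_all add: face_def\<close>)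
  then have "Lhat P R j (passes R j) \<le> Lstar R j"
    using kj(1,2) tail(2,4)[OF j] by (intro Lhat_le_Lstar_if_cuts_tight[of j k]) (auto simp: J1_def)
  then have "stops A R j" using tail[OF j] by (intro stops_if_Lhat_le_Lstar) auto
  then show False using no_stop tail(4)[OF j] by blast
qed

end

theorem theorem1:
  fixes P :: "('i::finite, 'v::finite, 'r::finite, 'o::finite, 'q::finite, 'y::finite, 'm::finite) mhsp"
    and A :: "('o, 'q) parameters"
    and R :: "('i, 'v, 'o, 'q) run"
  assumes "well_formed P"
    and "standing_condition P"
    and "valid_parameters P A"
    and "execution P A R"
  shows "\<exists>J. reached A R J \<and> stops A R J \<and>
           (\<exists>k \<in> {1..J}. ereal (Ubd R k) = Ustar R J) \<and>
           (\<forall>k \<in> {1..J}. ereal (Ubd R k) = Ustar R J \<longrightarrow> eps_optimal P (tol A) (xRMP R k))"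
proof -
  interpret benders_execution P A R using assms by unfold_locales
  obtain J where "reached A R J" "stops A R J" using eventually_stops by blast
  then show ?thesis using Ustar_attained stops_eps_optimal by blast
qed

end
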